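(* Suppose $(\mathsf P,\mathsf{Opens})$ is a semitopology and $p\in\mathsf P$. Then the following are equivalent: \begin{enumerate} \item $p$ is regular. \item $p$ is quasiregular and hypertransitive. \end{enumerate}
   Context: A semitopology is a pair $(\mathsf P,\mathsf{Opens})$ with $\mathsf{Opens}\subseteq\mathcal P(\mathsf P)$ containing $\varnothing$ and $\mathsf P$ and closed under arbitrary unions. Points $p,p'$ are intertwined when every open neighbourhood of $p$ intersects every open neighbourhood of $p'$; $p_{\between}$ denotes the set of points intertwined with $p$. $\mathrm{interior}(X)$ is the union of open sets contained in $X$. The community of $p$ is $K(p)=\mathrm{interior}(p_{\between})$. $p$ is regular when $p\in K(p)$ and $K(p)$ is nonempty, open and transitive (for all open $O,O'$, if $O\cap K(p)\neq\varnothing$ and $K(p)\cap O'\neq\varnothing$ then $O\cap O'\neq\varnothing$); quasiregular when $K(p)\neq\varnothing$. $p$ is hypertransitive when for all $O',O''\in\mathsf{Opens}$, if $O'$ intersects every open neighbourhood of $p$ and $O''$ intersects every open neighbourhood of $p$, then $O'\cap O''\neq\varnothing$. *)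

theory Defs
  imports Main
begin

definition semitopology :: "'a set \<Rightarrow> 'a set set \<Rightarrow> bool" where
  "semitopology P Opens \<longleftrightarrow>
     Opens \<subseteq> Pow P \<and> {} \<in> Opens \<and> P \<in> Opens \<and> (\<forall>\<O> \<subseteq> Opens. \<Union>\<O> \<in> Opens)"

definition intertwined :: "'a set set \<Rightarrow> 'a \<Rightarrow> 'a \<Rightarrow> bool" where
  "intertwined Opens p p' \<longleftrightarrow>
     (\<forall>U\<in>Opens. \<forall>U'\<in>Opens. p \<in> U \<longrightarrow> p' \<in> U' \<longrightarrow> U \<inter> U' \<noteq> {})"

definition intertwined_set :: "'a set \<Rightarrow> 'a set set \<Rightarrow> 'a \<Rightarrow> 'a set" where
  "intertwined_set P Opens p = {p' \<in> P. intertwined Opens p p'}"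

definition semi_interior :: "'a set set \<Rightarrow> 'a set \<Rightarrow> 'a set" where
  "semi_interior Opens X = \<Union>{U \<in> Opens. U \<subseteq> X}"

definition community :: "'a set \<Rightarrow> 'a set set \<Rightarrow> 'a \<Rightarrow> 'a set" where
  "community P Opens p = semi_interior Opens (intertwined_set P Opens p)"

definition transitive_set :: "'a set set \<Rightarrow> 'a set \<Rightarrow> bool" where
  "transitive_set Opens T \<longleftrightarrow>
     (\<forall>U\<in>Opens. \<forall>U'\<in>Opens. U \<inter> T \<noteq> {} \<longrightarrow> T \<inter> U' \<noteq> {} \<longrightarrow> U \<inter> U' \<noteq> {})"

definition regular_point :: "'a set \<Rightarrow> 'a set set \<Rightarrow> 'a \<Rightarrow> bool" where
  "regular_point P Opens p \<longleftrightarrow>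
     p \<in> community P Opens p \<and> community P Opens p \<noteq> {} \<and>
     community P Opens p \<in> Opens \<and> transitive_set Opens (community P Opens p)"

definition quasiregular_point :: "'a set \<Rightarrow> 'a set set \<Rightarrow> 'a \<Rightarrow> bool" where
  "quasiregular_point P Opens p \<longleftrightarrow> community P Opens p \<noteq> {}"

definition hypertransitive_point :: "'a set set \<Rightarrow> 'a \<Rightarrow> bool" where
  "hypertransitive_point Opens p \<longleftrightarrow>
     (\<forall>U'\<in>Opens. \<forall>U''\<in>Opens.
        (\<forall>U\<in>Opens. p \<in> U \<longrightarrow> U' \<inter> U \<noteq> {}) \<longrightarrow>
        (\<forall>U\<in>Opens. p \<in> U \<longrightarrow> U'' \<inter> U \<noteq> {}) \<longrightarrow>
        U' \<inter> U'' \<noteq> {})"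

end

theory Submission
  imports Defs
begin

text \<open>
  An open set meeting \<open>K(p)\<close> contains a point intertwined with \<open>p\<close>, hence meets every open
  neighbourhood of \<open>p\<close>; so hypertransitivity makes \<open>K(p)\<close> transitive. If \<open>p\<close> were not in
  \<open>K(p)\<close>, every open neighbourhood of \<open>p\<close> would contain a point not intertwined with \<open>p\<close>, so the
  union of all open sets that miss some open neighbourhood of \<open>p\<close> would meet every open
  neighbourhood of \<open>p\<close>. The same holds for \<open>K(p)\<close> if it is nonempty, so by hypertransitivity the
  two sets intersect, which is impossible by the first remark.
\<close>

lemma semi_interior_open:
  assumes "semitopology P Opens"
  shows "semi_interior Opens X \<in> Opens"
proof -
  have "{U \<in> Opens. U \<subseteq> X} \<subseteq> Opens" by blast
  then show ?thesis
    using assms unfolding semitopology_def semi_interior_def by blast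
qed

lemma intertwined_if_in_community:
  "x \<in> community P Opens p \<Longrightarrow> intertwined Opens p x"
  unfolding community_def semi_interior_def intertwined_set_def by blast

lemma open_meeting_community_meets_neighbourhoods:
  assumes "V \<in> Opens" and "V \<inter> community P Opens p \<noteq> {}"
    and "U \<in> Opens" and "p \<in> U"
  shows "V \<inter> U \<noteq> {}"
proof -
  obtain x where "x \<in> V" and "x \<in> community P Opens p"
    using assms(2) by blast
  then have "intertwined Opens p x" by (simp add: intertwined_if_in_community)
  then have "U \<inter> V \<noteq> {}"
    using assms \<open>x \<in> V\<close> unfolding intertwined_def by blast
  then show ?thesis by blast
qed

lemma hypertransitive_imp_community_transitive:
  assumes "hypertransitive_point Opens p"
  shows "transitive_set Opens (community P Opens p)"
  unfolding transitive_set_def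
proof (intro ballI impI)
  fix U U'
  assume U: "U \<in> Opens" "U \<inter> community P Opens p \<noteq> {}"
    and U': "U' \<in> Opens" "community P Opens p \<inter> U' \<noteq> {}"
  have "\<forall>W\<in>Opens. p \<in> W \<longrightarrow> U \<inter> W \<noteq> {}"
    using open_meeting_community_meets_neighbourhoods[OF U] by blast
  moreover have "\<forall>W\<in>Opens. p \<in> W \<longrightarrow> U' \<inter> W \<noteq> {}"
    using open_meeting_community_meets_neighbourhoods[of U' Opens P p] U'
    by (simp add: Int_commute)
  ultimately show "U \<inter> U' \<noteq> {}"
    using assms U(1) U'(1) unfolding hypertransitive_point_def by simp
qed

lemma quasiregular_hypertransitive_imp_in_community:
  assumes semi: "semitopology P Opens"
    and quasi: "quasiregular_point P Opens p"
    and hyper: "hypertransitive_point Opens p"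
  shows "p \<in> community P Opens p"
proof (rule ccontr)
  let ?K = "community P Opens p"
  \<comment> \<open>The union of this family is exactly the set of points of \<open>P\<close> not
    intertwined with \<open>p\<close>, so that set is open.\<close>
  let ?\<V> = "{V \<in> Opens. \<exists>W\<in>Opens. p \<in> W \<and> V \<inter> W = {}}"
  assume notin: "p \<notin> ?K"
  have K: "?K \<in> Opens" "?K \<noteq> {}"
    using semi quasi
    by (simp_all add: community_def quasiregular_point_def semi_interior_open)
  have "?\<V> \<subseteq> Opens" by blast
  then have "\<Union>?\<V> \<in> Opens" using semi unfolding semitopology_def by blast
  moreover have "\<forall>U\<in>Opens. p \<in> U \<longrightarrow> \<Union>?\<V> \<inter> U \<noteq> {}"
  proof (intro ballI impI)
    fix U assume U: "U \<in> Opens" "p \<in> U"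
    \<comment> \<open>Otherwise \<open>U\<close> would be one of the open sets whose union is
      \<open>?K\<close>, which would put \<open>p\<close> into \<open>?K\<close>.\<close>
    then have "\<not> U \<subseteq> intertwined_set P Opens p"
      using notin unfolding community_def semi_interior_def by blast
    then obtain x where x: "x \<in> U" "x \<notin> intertwined_set P Opens p" by blast
    moreover have "x \<in> P" using U(1) x(1) semi unfolding semitopology_def by blast
    ultimately obtain W V where "W \<in> Opens" "p \<in> W" "V \<in> Opens" "x \<in> V" "W \<inter> V = {}"
      unfolding intertwined_set_def intertwined_def by blast
    then have "x \<in> \<Union>?\<V>" by blast
    then show "\<Union>?\<V> \<inter> U \<noteq> {}" using x(1) by blast
  qed
  moreover have "\<forall>U\<in>Opens. p \<in> U \<longrightarrow> ?K \<inter> U \<noteq> {}"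
    \<comment> \<open>The open set is taken to be \<open>?K\<close> itself, which meets
      \<open>?K\<close> because it is nonempty.\<close>
    using open_meeting_community_meets_neighbourhoods[OF K(1), of P p] K(2) by simp
  ultimately have "\<Union>?\<V> \<inter> ?K \<noteq> {}"
    using hyper K(1) unfolding hypertransitive_point_def by simp
  \<comment> \<open>A common point lies in a single member \<open>V\<close> of the family, and
    membership supplies a neighbourhood \<open>W\<close> of \<open>p\<close> that \<open>V\<close>
    misses although it meets \<open>?K\<close>.\<close>
  then obtain V W where "V \<in> Opens" "V \<inter> ?K \<noteq> {}" "W \<in> Opens" "p \<in> W" "V \<inter> W = {}"
    by blast
  then show False
    using open_meeting_community_meets_neighbourhoods by metis
qed

text \<open>Regularity makes K(p) itself an open neighbourhood of \<open>p\<close>. Both given open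
  sets therefore meet K(p), and its transitivity makes them meet each other.\<close>

lemma regular_imp_hypertransitive:
  assumes "regular_point P Opens p"
  shows "hypertransitive_point Opens p"
  unfolding hypertransitive_point_def
proof (intro ballI impI)
  fix U' U''
  assume "U' \<in> Opens" "U'' \<in> Opens"
    and "\<forall>U\<in>Opens. p \<in> U \<longrightarrow> U' \<inter> U \<noteq> {}" "\<forall>U\<in>Opens. p \<in> U \<longrightarrow> U'' \<inter> U \<noteq> {}"
  then show "U' \<inter> U'' \<noteq> {}"
    using assms unfolding regular_point_def transitive_set_def
    by (metis Int_commute)
qed

theorem theorem6p34:
  fixes P :: "'a set" and Opens :: "'a set set" and p :: 'a
  assumes "semitopology P Opens" and "p \<in> P"
  shows "regular_point P Opens p \<longleftrightarrow>
         quasiregular_point P Opens p \<and> hypertransitive_point Opens p"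
proof
  assume "regular_point P Opens p"
  then show "quasiregular_point P Opens p \<and> hypertransitive_point Opens p"
    by (simp add: regular_imp_hypertransitive quasiregular_point_def)
      (simp add: regular_point_def)
next
  assume "quasiregular_point P Opens p \<and> hypertransitive_point Opens p"
  then have quasi: "quasiregular_point P Opens p" and hyper: "hypertransitive_point Opens p"
    by simp_all
  have "community P Opens p \<in> Opens"
    using assms(1) by (simp add: community_def semi_interior_open)
  then show "regular_point P Opens p"
    using quasiregular_hypertransitive_imp_in_community[OF assms(1) quasi hyper]
      hypertransitive_imp_community_transitive[OF hyper]
    unfolding regular_point_def by blast
qed

end
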